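(* Let $R$ be an associative (not necessarily commutative) ring with unity such that $|\mathrm{Max}(R)|\geq 2$. If there exists a vertex of $\Gamma_2(R)\backslash J(R)$ which is adjacent to every other vertex of $\Gamma_2(R)\backslash J(R)$, then $R\cong \mathbb{Z}_2\times D$, where $D$ is a division ring.
   Context: $\mathrm{Max}(R)$ denotes the set of all maximal left ideals of $R$, and $J(R)$ denotes the Jacobson radical of $R$. The comaximal graph $\Gamma(R)$ is the graph whose vertices are the elements of $R$, where two distinct vertices $a$ and $b$ are adjacent if and only if $Ra+Rb=R$. $\Gamma_2(R)$ is the subgraph of $\Gamma(R)$ induced on the non-unit elements of $R$, and $\Gamma_2(R)\backslash J(R)$ is the subgraph of $\Gamma(R)$ induced on the non-unit elements of $R$ that do not belong to $J(R)$. $\mathbb{Z}_2$ is the field with two elements.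
   Formalization: "Non-unit" is taken to mean an element a with Ra ≠ R (no left inverse); with two-sided units the claim fails, e.g. in End(V), V infinite-dimensional, where a non-unit a with ba = 1 is adjacent to every other vertex. *)

theory Defs
  imports "HOL-Algebra.Algebra" "HOL-Number_Theory.Residues"
begin

definition left_ideal :: "'a set \<Rightarrow> ('a, 'm) ring_scheme \<Rightarrow> bool" where
  "left_ideal I R \<longleftrightarrow> additive_subgroup I R \<and> (\<forall>r\<in>carrier R. \<forall>x\<in>I. r \<otimes>\<^bsub>R\<^esub> x \<in> I)"

definition Max_left :: "('a, 'm) ring_scheme \<Rightarrow> 'a set set" where
  "Max_left R = {M. left_ideal M R \<and> M \<noteq> carrier R \<and>
     (\<forall>I. left_ideal I R \<longrightarrow> M \<subseteq> I \<longrightarrow> I = M \<or> I = carrier R)}"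

definition Jacobson_radical :: "('a, 'm) ring_scheme \<Rightarrow> 'a set" where
  "Jacobson_radical R = carrier R \<inter> \<Inter>(Max_left R)"

definition division_ring :: "('a, 'm) ring_scheme \<Rightarrow> bool" where
  "division_ring D \<longleftrightarrow> ring D \<and> Units D = carrier D - {\<zero>\<^bsub>D\<^esub>}"

definition left_units :: "('a, 'm) ring_scheme \<Rightarrow> 'a set" where
  "left_units R = {a \<in> carrier R. \<exists>b\<in>carrier R. b \<otimes>\<^bsub>R\<^esub> a = \<one>\<^bsub>R\<^esub>}"

text \<open>A graph is a pair of its vertex set and its adjacency relation.\<close>

type_synonym 'a graph = "'a set \<times> ('a \<times> 'a) set"

abbreviation vertices :: "'a graph \<Rightarrow> 'a set" where
  "vertices G \<equiv> fst G"

abbreviation adjacent :: "'a graph \<Rightarrow> 'a \<Rightarrow> 'a \<Rightarrow> bool" where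
  "adjacent G a b \<equiv> (a, b) \<in> snd G"

definition induced_subgraph :: "'a graph \<Rightarrow> 'a set \<Rightarrow> 'a graph" where
  "induced_subgraph G S = (vertices G \<inter> S, snd G \<inter> (S \<times> S))"

text \<open>Here \<open>carrier R #> a\<close> is the principal left ideal \<open>R a\<close> and \<open><+>\<close> is the
  elementwise sum of subsets.\<close>

definition comaximal_graph :: "('a, 'm) ring_scheme \<Rightarrow> 'a graph" where
  "comaximal_graph R =
     (carrier R,
      {(a, b). a \<in> carrier R \<and> b \<in> carrier R \<and> a \<noteq> b \<and>
         (carrier R #>\<^bsub>R\<^esub> a) <+>\<^bsub>R\<^esub> (carrier R #>\<^bsub>R\<^esub> b) = carrier R})"

text \<open>In this one-sided setting a unit is an element \<open>a\<close> with \<open>R a = R\<close>, so that the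
  non-units are the elements lying in some maximal left ideal. This is the usual notion
  of unit whenever one-sided inverses are two-sided (lemma \<open>left_units_eq_Units\<close>). In general
  the distinction matters: an element \<open>a\<close> that is only left invertible is
  adjacent to every other element of \<open>R\<close> (lemma \<open>left_unit_adjacent\<close>), without any
  consequence for the structure of \<open>R\<close>.\<close>

definition comaximal_graph2 :: "('a, 'm) ring_scheme \<Rightarrow> 'a graph" where
  "comaximal_graph2 R = induced_subgraph (comaximal_graph R) (carrier R - left_units R)"

definition comaximal_graph2_minus_J :: "('a, 'm) ring_scheme \<Rightarrow> 'a graph" where
  "comaximal_graph2_minus_J R =
     induced_subgraph (comaximal_graph2 R) (carrier R - Jacobson_radical R)"

lemma (in ring) left_units_eq_Units:
  assumes "\<And>a b. a \<in> carrier R \<Longrightarrow> b \<in> carrier R \<Longrightarrow> b \<otimes> a = \<one> \<Longrightarrow> a \<otimes> b = \<one>"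
  shows "left_units R = Units R"
  using assms unfolding left_units_def Units_def by blast

lemma (in ring) left_unit_adjacent:
  assumes "a \<in> left_units R" "b \<in> carrier R" "a \<noteq> b"
  shows "adjacent (comaximal_graph R) a b"
proof -
  obtain c where c: "a \<in> carrier R" "c \<in> carrier R" "c \<otimes> a = \<one>"
    using assms(1) unfolding left_units_def by blast
  have "x \<in> (carrier R #> a) <+>\<^bsub>R\<^esub> (carrier R #> b)" if x: "x \<in> carrier R" for x
  proof -
    have "x = (x \<otimes> c) \<otimes> a \<oplus> \<zero> \<otimes> b"
      using x c assms(2) by (simp add: m_assoc)
    moreover have "(x \<otimes> c) \<otimes> a \<in> carrier R #> a" "\<zero> \<otimes> b \<in> carrier R #> b"
      using x c assms(2) unfolding r_coset_def by blast+
    ultimately show ?thesis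
      unfolding set_add_def' by blast
  qed
  moreover have "(carrier R #> a) <+>\<^bsub>R\<^esub> (carrier R #> b) \<subseteq> carrier R"
    using c assms(2) unfolding set_add_def' r_coset_def by auto
  ultimately show ?thesis
    using c assms unfolding comaximal_graph_def by auto
qed

end

theory Submission
  imports Defs
begin

text \<open>Let \<open>a\<close> be the dominating vertex. A proper left ideal containing \<open>a\<close> contains no
  other vertex, so it lies in \<open>J \<union> {a}\<close>. Hence a maximal left ideal containing \<open>a\<close> is
  \<open>{0, a}\<close> and \<open>J = 0\<close>. A maximal left ideal avoiding \<open>a\<close> is a complement of \<open>{0, a}\<close>,
  which makes \<open>a\<close> idempotent. The left annihilator of \<open>a\<close> is a simple left module, so
  if \<open>a r (1 - a) \<noteq> 0\<close> then \<open>1 - a\<close> is a left multiple of it, which forces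
  \<open>1 - a = a r (1 - a)\<close> and so \<open>1 - a = 0\<close>. Thus \<open>a\<close> is central, and \<open>R\<close> is the product of
  \<open>R a = {0, a}\<close> and the division ring \<open>R (1 - a)\<close>.\<close>

section \<open>Left ideals and maximal left ideals\<close>

lemma (in ring) left_idealD:
  assumes "left_ideal I R"
  shows "I \<subseteq> carrier R" "\<zero> \<in> I"
    "\<And>x y. x \<in> I \<Longrightarrow> y \<in> I \<Longrightarrow> x \<oplus> y \<in> I"
    "\<And>x y. x \<in> I \<Longrightarrow> y \<in> I \<Longrightarrow> x \<ominus> y \<in> I"
    "\<And>r x. r \<in> carrier R \<Longrightarrow> x \<in> I \<Longrightarrow> r \<otimes> x \<in> I"
proof -
  interpret additive_subgroup I R
    using assms unfolding left_ideal_def by blast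
  have inv: "\<ominus> x \<in> I" if "x \<in> I" for x
    using subgroup.m_inv_closed[OF a_subgroup, of x] that by (simp add: a_inv_def)
  show "I \<subseteq> carrier R" "\<zero> \<in> I" "\<And>x y. x \<in> I \<Longrightarrow> y \<in> I \<Longrightarrow> x \<oplus> y \<in> I"
    "\<And>r x. r \<in> carrier R \<Longrightarrow> x \<in> I \<Longrightarrow> r \<otimes> x \<in> I"
    using assms a_subset unfolding left_ideal_def by auto
  show "\<And>x y. x \<in> I \<Longrightarrow> y \<in> I \<Longrightarrow> x \<ominus> y \<in> I"
    using inv by (simp add: minus_eq)
qed

lemma (in ring) left_idealI:
  assumes "I \<subseteq> carrier R" "\<zero> \<in> I"
    and "\<And>x y. x \<in> I \<Longrightarrow> y \<in> I \<Longrightarrow> x \<oplus> y \<in> I"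
    and mult: "\<And>r x. r \<in> carrier R \<Longrightarrow> x \<in> I \<Longrightarrow> r \<otimes> x \<in> I"
  shows "left_ideal I R"
proof -
  have inv: "\<ominus> x \<in> I" if "x \<in> I" for x
    using mult[of "\<ominus> \<one>" x] that assms(1) by (auto simp: l_minus)
  then have "inv\<^bsub>add_monoid R\<^esub> x \<in> I" if "x \<in> I" for x
    using that by (simp add: a_inv_def)
  then have "subgroup I (add_monoid R)"
    using assms by (intro add.subgroupI) (auto simp: a_inv_def)
  then show ?thesis
    unfolding left_ideal_def using mult by (simp add: additive_subgroupI)
qed

lemma (in ring) left_ideal_one:
  assumes "left_ideal I R" "\<one> \<in> I"
  shows "I = carrier R"
  using left_idealD(1)[OF assms(1)] left_idealD(5)[OF assms(1) _ assms(2)] by force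

text \<open>The left ideal I + Rx enlarges \<open>I\<close> by one element; it is used for maximal
  \<open>I\<close> and, with \<open>I\<close> the zero ideal, for Rx itself.\<close>

lemma (in ring) left_ideal_set_add_principal:
  assumes "left_ideal I R" "x \<in> carrier R"
  shows "left_ideal {y \<oplus> r \<otimes> x |y r. y \<in> I \<and> r \<in> carrier R} R" (is "left_ideal ?S R")
proof (rule left_idealI)
  note I = left_idealD[OF assms(1)]
  show "?S \<subseteq> carrier R" using I(1) assms(2) by auto
  show "\<zero> \<in> ?S"
    using I(2) assms(2) by (intro CollectI exI[of _ \<zero>]) simp
  show "u \<oplus> v \<in> ?S" if uv: "u \<in> ?S" "v \<in> ?S" for u v
  proof -
    obtain y r z s where *: "u = y \<oplus> r \<otimes> x" "v = z \<oplus> s \<otimes> x"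
      "y \<in> I" "z \<in> I" "r \<in> carrier R" "s \<in> carrier R"
      using uv by blast
    moreover have "y \<in> carrier R" "z \<in> carrier R" using * I(1) by auto
    ultimately have "u \<oplus> v = (y \<oplus> z) \<oplus> (r \<oplus> s) \<otimes> x"
      using assms(2) by (simp add: l_distr a_ac)
    then show ?thesis using * I(3) by blast
  qed
  show "t \<otimes> u \<in> ?S" if t: "t \<in> carrier R" and u: "u \<in> ?S" for t u
  proof -
    obtain y r where *: "u = y \<oplus> r \<otimes> x" "y \<in> I" "r \<in> carrier R"
      using u by blast
    moreover have "y \<in> carrier R" using * I(1) by auto
    ultimately have "t \<otimes> u = (t \<otimes> y) \<oplus> (t \<otimes> r) \<otimes> x"
      using assms(2) t by (simp add: r_distr m_assoc)
    then show ?thesis using * t I(5) by blast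
  qed
qed

lemma (in ring) left_ideal_principal:
  assumes "x \<in> carrier R"
  shows "left_ideal {r \<otimes> x |r. r \<in> carrier R} R"
proof -
  have "left_ideal {\<zero>} R" by (rule left_idealI) auto
  moreover have "{y \<oplus> r \<otimes> x |y r. y \<in> {\<zero>} \<and> r \<in> carrier R} = {r \<otimes> x |r. r \<in> carrier R}"
    using assms by (force simp: r_distr)
  ultimately show ?thesis
    using left_ideal_set_add_principal[OF _ assms, of "{\<zero>}"] by simp
qed

text \<open>M + Rx contains \<open>M\<close> and also \<open>x\<close>, so maximality makes it the
  whole ring. The element \<open>z\<close> is free because both \<one> and 1 - a get decomposed
  later.\<close>

lemma (in ring) Max_left_comaximal:
  assumes "M \<in> Max_left R" "x \<in> carrier R" "x \<notin> M" "z \<in> carrier R"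
  obtains m r where "m \<in> M" "r \<in> carrier R" "z = m \<oplus> r \<otimes> x"
proof -
  let ?S = "{y \<oplus> r \<otimes> x |y r. y \<in> M \<and> r \<in> carrier R}"
  have M: "left_ideal M R"
    and max: "\<And>I. left_ideal I R \<Longrightarrow> M \<subseteq> I \<Longrightarrow> I = M \<or> I = carrier R"
    using assms(1) unfolding Max_left_def by auto
  have "M \<subseteq> ?S"
  proof
    fix y assume y: "y \<in> M"
    then have "y = y \<oplus> \<zero> \<otimes> x"
      using left_idealD(1)[OF M] assms(2) by auto
    then show "y \<in> ?S" using y by blast
  qed
  moreover have "x \<in> ?S"
    using assms(2) left_idealD(2)[OF M]
    by (intro CollectI exI[of _ \<zero>] exI[of _ \<one>]) simp
  ultimately have "?S = carrier R"
    using max[OF left_ideal_set_add_principal[OF M assms(2)]] assms(3) by blast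
  then show thesis using assms(4) that by blast
qed

section \<open>Splitting along a central idempotent\<close>

text \<open>For a central idempotent \<open>a\<close> this annihilator is the corner ring R(1 - a)
  with identity 1 - a. By \<open>simple\<close> every nonzero element has a left inverse relative to
  1 - a, and when all nonzero elements have left inverses, these are two-sided.\<close>

lemma (in ring) division_ring_annihilator:
  assumes a: "a \<in> carrier R" "a \<otimes> a = a" "a \<noteq> \<one>"
    and central: "\<And>r. r \<in> carrier R \<Longrightarrow> a \<otimes> r = r \<otimes> a"
    and simple: "\<And>x. x \<in> carrier R \<Longrightarrow> x \<otimes> a = \<zero> \<Longrightarrow> x \<noteq> \<zero>
      \<Longrightarrow> \<exists>s\<in>carrier R. s \<otimes> x = \<one> \<ominus> a"
  shows "division_ring \<lparr>carrier = {x \<in> carrier R. x \<otimes> a = \<zero>}, monoid.mult = (\<otimes>), one = \<one> \<ominus> a,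
    ring.zero = \<zero>, ring.add = (\<oplus>)\<rparr>" (is "division_ring ?D")
proof -
  define f where "f = \<one> \<ominus> a"
  have f: "f \<in> carrier R" "f \<otimes> a = \<zero>"
    unfolding f_def using a by (simp_all add: minus_eq l_distr l_minus r_neg)
  have f0: "f \<noteq> \<zero>" unfolding f_def using a(1,3) by simp
  have xf: "x \<otimes> f = x" if "x \<in> carrier R" "x \<otimes> a = \<zero>" for x
    unfolding f_def using that a by (simp add: minus_eq r_distr r_minus)
  have fx: "f \<otimes> x = x" if "x \<in> carrier R" "x \<otimes> a = \<zero>" for x
    unfolding f_def using that a central[OF that(1)] by (simp add: minus_eq l_distr l_minus)
  have mult: "x \<otimes> y \<otimes> a = \<zero>"
    if "x \<in> carrier R" "y \<in> carrier R" "y \<otimes> a = \<zero>" for x y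
    using that a by (simp add: m_assoc)
  have "abelian_group ?D"
  proof (rule abelian_groupI)
    fix x assume x: "x \<in> carrier ?D"
    then have "\<ominus> x \<in> carrier ?D" "\<ominus> x \<oplus>\<^bsub>?D\<^esub> x = \<zero>\<^bsub>?D\<^esub>"
      using a by (auto simp: l_minus l_neg)
    then show "\<exists>y\<in>carrier ?D. y \<oplus>\<^bsub>?D\<^esub> x = \<zero>\<^bsub>?D\<^esub>" by blast
  qed (use a in \<open>auto simp: l_distr a_ac\<close>)
  moreover have "monoid ?D"
    by (rule monoidI) (use a f fx xf mult in \<open>auto simp: m_assoc f_def[symmetric]\<close>)
  ultimately have D: "ring ?D"
    by (intro ringI) (auto simp: l_distr r_distr)
  have left_inv: "\<exists>s\<in>carrier ?D. s \<otimes> x = f" if x: "x \<in> carrier ?D" "x \<noteq> \<zero>" for x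
  proof -
    obtain s where s: "s \<in> carrier R" "s \<otimes> x = f"
      using simple x unfolding f_def by auto
    \<comment> \<open>The \<open>s\<close> supplied by \<open>simple\<close> lies only in
      \<open>R\<close>. Right multiplication by \<open>f\<close> moves it into the annihilator and
      keeps the product with \<open>x\<close>, since fx = x.\<close>
    have "s \<otimes> f \<in> carrier ?D" using s f mult by simp
    moreover have "s \<otimes> f \<otimes> x = f" using s f x fx by (simp add: m_assoc)
    ultimately show ?thesis by blast
  qed
  have "x \<in> Units ?D" if x: "x \<in> carrier ?D" "x \<noteq> \<zero>" for x
  proof -
    obtain s where s: "s \<in> carrier ?D" "s \<otimes> x = f" using left_inv x by blast
    \<comment> \<open>\<open>s\<close> has a left inverse \<open>t\<close> of its own, and t = t(sx)
      = (ts)x = x, so \<open>s\<close> is also a right inverse of \<open>x\<close>.\<close>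
    have "s \<noteq> \<zero>" using s f0 x by auto
    then obtain t where t: "t \<in> carrier ?D" "t \<otimes> s = f" using left_inv s by blast
    have "t = t \<otimes> (s \<otimes> x)" using s t xf by simp
    also have "\<dots> = (t \<otimes> s) \<otimes> x" using s(1) t(1) x by (simp add: m_assoc)
    also have "\<dots> = x" using t x fx by simp
    finally have "x \<otimes> s = f" using t by simp
    then show ?thesis using s x unfolding Units_def f_def by auto
  qed
  moreover have "\<zero> \<notin> Units ?D" using f0 unfolding Units_def f_def by auto
  ultimately have "Units ?D = carrier ?D - {\<zero>}" unfolding Units_def by blast
  then show ?thesis unfolding division_ring_def using D by simp
qed

text \<open>Peirce decomposition: r = ra + r(1 - a), and for a central idempotent both projections
  are multiplicative. By \<open>two\<close> the corner Ra is {0, a}, a copy of the field with two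
  elements.\<close>

lemma (in ring) iso_RDirProd_annihilator:
  assumes a: "a \<in> carrier R" "a \<otimes> a = a" "a \<noteq> \<zero>"
    and central: "\<And>r. r \<in> carrier R \<Longrightarrow> a \<otimes> r = r \<otimes> a"
    and two: "\<And>r. r \<in> carrier R \<Longrightarrow> r \<otimes> a = \<zero> \<or> r \<otimes> a = a"
  shows "R \<simeq> RDirProd (residue_ring 2)
    \<lparr>carrier = {x \<in> carrier R. x \<otimes> a = \<zero>}, monoid.mult = (\<otimes>), one = \<one> \<ominus> a,
      ring.zero = \<zero>, ring.add = (\<oplus>)\<rparr>" (is "R \<simeq> RDirProd _ ?D")
proof -
  \<comment> \<open>\<open>\<epsilon>\<close> encodes the component ra in {0, a} as a residue mod 2;
    \<open>\<pi>\<close> projects onto the annihilator.\<close>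
  define \<epsilon> :: "'a \<Rightarrow> int" where "\<epsilon> r = (if r \<otimes> a = \<zero> then 0 else 1)" for r
  define \<pi> where "\<pi> r = r \<ominus> r \<otimes> a" for r
  \<comment> \<open>By \<open>two\<close>, a + a = (a + a)a is 0 or a, and a + a = a would give a =
    0. Hence addition in {0, a} is addition mod 2.\<close>
  have aa: "a \<oplus> a = \<zero>"
  proof (rule ccontr)
    assume "a \<oplus> a \<noteq> \<zero>"
    then have "a \<oplus> a = a" using two[of "a \<oplus> a"] a by (simp add: l_distr)
    then show False using a by (metis add.r_cancel_one')
  qed
  have \<epsilon>_add: "\<epsilon> (r \<oplus> s) = (\<epsilon> r + \<epsilon> s) mod 2" if "r \<in> carrier R" "s \<in> carrier R" for r s
    using two[OF that(1)] two[OF that(2)] that a aa by (auto simp: \<epsilon>_def l_distr)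
  have ac: "r \<otimes> s \<otimes> a = (r \<otimes> a) \<otimes> (s \<otimes> a)" if "r \<in> carrier R" "s \<in> carrier R" for r s
  proof -
    have "(r \<otimes> a) \<otimes> (s \<otimes> a) = r \<otimes> ((a \<otimes> s) \<otimes> a)" using that a by (simp add: m_assoc)
    also have "a \<otimes> s \<otimes> a = s \<otimes> a" using that a central[OF that(2)] by (simp add: m_assoc)
    also have "r \<otimes> (s \<otimes> a) = r \<otimes> s \<otimes> a" using that a by (simp add: m_assoc)
    finally show ?thesis by simp
  qed
  have \<epsilon>_mult: "\<epsilon> (r \<otimes> s) = (\<epsilon> r * \<epsilon> s) mod 2" if "r \<in> carrier R" "s \<in> carrier R" for r s
    using two[OF that(1)] two[OF that(2)] that a ac[OF that] by (auto simp: \<epsilon>_def)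
  have \<pi>_closed: "\<pi> r \<in> carrier R" "\<pi> r \<otimes> a = \<zero>" if "r \<in> carrier R" for r
    using that a by (simp_all add: \<pi>_def minus_eq l_distr l_minus m_assoc r_neg)
  have \<pi>_add: "\<pi> (r \<oplus> s) = \<pi> r \<oplus> \<pi> s" if "r \<in> carrier R" "s \<in> carrier R" for r s
    using that a by (simp add: \<pi>_def minus_eq l_distr minus_add a_ac)
  have \<pi>_mult: "\<pi> (r \<otimes> s) = \<pi> r \<otimes> \<pi> s" if "r \<in> carrier R" "s \<in> carrier R" for r s
  \<comment> \<open>Expand the second factor as s - sa. The term with sa vanishes, since centrality
    moves \<open>a\<close> next to \<open>\<pi> r\<close>, which it annihilates.\<close>
  proof -
    have "\<pi> r \<otimes> \<pi> s = \<pi> r \<otimes> s \<ominus> \<pi> r \<otimes> (s \<otimes> a)"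
      using that a \<pi>_closed unfolding \<pi>_def[of s] by (simp add: minus_eq r_distr r_minus)
    also have "\<pi> r \<otimes> (s \<otimes> a) = \<pi> r \<otimes> a \<otimes> s"
      using central[OF that(2)] m_assoc[OF \<pi>_closed(1)[OF that(1)] a(1) that(2)] by simp
    also have "\<dots> = \<zero>" using that \<pi>_closed by simp
    also have "\<pi> r \<otimes> s = r \<otimes> s \<ominus> r \<otimes> a \<otimes> s"
      using that a by (simp add: \<pi>_def minus_eq l_distr l_minus)
    also have "r \<otimes> a \<otimes> s = r \<otimes> s \<otimes> a" using that a central[OF that(2)] by (simp add: m_assoc)
    finally show ?thesis using that a by (simp add: \<pi>_def minus_eq)
  qed
  have decomp: "r = \<pi> r \<oplus> r \<otimes> a" if "r \<in> carrier R" for r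
    using that a by (simp add: \<pi>_def minus_eq a_assoc l_neg)
  have "(\<lambda>r. (\<epsilon> r, \<pi> r)) \<in> ring_iso R (RDirProd (residue_ring 2) ?D)"
  proof (rule ring_iso_memI)
    show "bij_betw (\<lambda>r. (\<epsilon> r, \<pi> r)) (carrier R) (carrier (RDirProd (residue_ring 2) ?D))"
      unfolding RDirProd_carrier
    proof (rule bij_betw_imageI)
      show "inj_on (\<lambda>r. (\<epsilon> r, \<pi> r)) (carrier R)"
      proof (rule inj_onI)
        fix r s assume rs: "r \<in> carrier R" "s \<in> carrier R" "(\<epsilon> r, \<pi> r) = (\<epsilon> s, \<pi> s)"
        have "r \<otimes> a = s \<otimes> a"
          using two[OF rs(1)] two[OF rs(2)] rs(3) by (auto simp: \<epsilon>_def split: if_splits)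
        then show "r = s" using decomp rs by (metis prod.inject)
      qed
      show "(\<lambda>r. (\<epsilon> r, \<pi> r)) ` carrier R = carrier (residue_ring 2) \<times> carrier ?D"
      proof
        show "(\<lambda>r. (\<epsilon> r, \<pi> r)) ` carrier R \<subseteq> carrier (residue_ring 2) \<times> carrier ?D"
          using \<pi>_closed by (auto simp: \<epsilon>_def residue_ring_def)
        show "carrier (residue_ring 2) \<times> carrier ?D \<subseteq> (\<lambda>r. (\<epsilon> r, \<pi> r)) ` carrier R"
        proof clarify
          fix i x assume i: "i \<in> carrier (residue_ring 2)" and x: "x \<in> carrier ?D"
          define r where "r = x \<oplus> (if i = 0 then \<zero> else a)"
          have r: "r \<in> carrier R" "r \<otimes> a = (if i = 0 then \<zero> else a)"
            using x a by (auto simp: r_def l_distr)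
          have "i = 0 \<or> i = 1" using i by (auto simp: residue_ring_def)
          then have "\<epsilon> r = i" using r a by (auto simp: \<epsilon>_def)
          moreover have "\<pi> r = x"
            using r x a unfolding \<pi>_def by (auto simp: r_def minus_eq a_assoc r_neg)
          ultimately show "(i, x) \<in> (\<lambda>r. (\<epsilon> r, \<pi> r)) ` carrier R" using r by blast
        qed
      qed
    qed
  qed (use a \<epsilon>_add \<epsilon>_mult \<pi>_closed \<pi>_add \<pi>_mult in
      \<open>auto simp: RDirProd_def DirProd_def monoid.defs residue_ring_def \<epsilon>_def \<pi>_def\<close>)
  then show ?thesis unfolding is_ring_iso_def by blast
qed

section \<open>Left ideals containing a dominating vertex\<close>

text \<open>Another \<open>b\<close> in \<open>I\<close> outside the radical would be a vertex,
  since a left unit in \<open>I\<close> would give \<one> in \<open>I\<close>. Then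
  \<open>dom\<close> would put \<one> = ra + sb into the proper left ideal \<open>I\<close>.\<close>

lemma (in ring) dominating_left_ideal:
  assumes a: "a \<in> carrier R"
    and dom: "\<And>b. b \<in> carrier R \<Longrightarrow> b \<notin> left_units R \<Longrightarrow> b \<notin> Jacobson_radical R \<Longrightarrow> b \<noteq> a
      \<Longrightarrow> \<exists>r\<in>carrier R. \<exists>s\<in>carrier R. \<one> = r \<otimes> a \<oplus> s \<otimes> b"
    and I: "left_ideal I R" "I \<noteq> carrier R" "a \<in> I"
  shows "I \<subseteq> insert a (Jacobson_radical R)"
proof
  fix b assume b: "b \<in> I"
  note ID = left_idealD[OF I(1)]
  have one: "\<one> \<notin> I" using left_ideal_one I by blast
  have "b \<notin> left_units R" unfolding left_units_def using one ID(5)[OF _ b] by force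
  then show "b \<in> insert a (Jacobson_radical R)"
    using dom[of b] b one ID I(3) by (metis insertCI subsetD)
qed

text \<open>Zorn's lemma is avoided: if no maximal left ideal contains \<open>a\<close>, then \<open>1 - a \<in> J\<close>
  and every maximal left ideal equals \<open>J\<close>, contradicting the existence of two.\<close>

lemma (in ring) dominating_in_Max_left:
  assumes a: "a \<in> carrier R" "a \<notin> left_units R"
    and dom: "\<And>b. b \<in> carrier R \<Longrightarrow> b \<notin> left_units R \<Longrightarrow> b \<notin> Jacobson_radical R \<Longrightarrow> b \<noteq> a
      \<Longrightarrow> \<exists>r\<in>carrier R. \<exists>s\<in>carrier R. \<one> = r \<otimes> a \<oplus> s \<otimes> b"
    and two: "L \<in> Max_left R" "N \<in> Max_left R" "L \<noteq> N"
  shows "\<exists>M\<in>Max_left R. a \<in> M"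
proof (rule ccontr)
  assume none: "\<not> ?thesis"
  let ?J = "Jacobson_radical R" and ?P = "{r \<otimes> a |r. r \<in> carrier R}"
  have JM: "?J \<subseteq> M" if "M \<in> Max_left R" for M
    using that unfolding Jacobson_radical_def by blast
  have "\<one> \<notin> ?P" using a unfolding left_units_def by auto
  then have "?P \<noteq> carrier R" by blast
  moreover have "a \<in> ?P" using a by (intro CollectI exI[of _ \<one>]) simp
  ultimately have PJ: "?P \<subseteq> insert a ?J"
    using dominating_left_ideal[OF a(1) dom left_ideal_principal[OF a(1)]] by blast
  have M_J: "M \<subseteq> ?J" if M: "M \<in> Max_left R" for M
  proof
    fix x assume x: "x \<in> M"
    have LM: "left_ideal M R" "M \<noteq> carrier R" using M unfolding Max_left_def by auto
    note MD = left_idealD[OF LM(1)]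
    have aM: "a \<notin> M" using none M by blast
    have one: "\<one> \<notin> M" using left_ideal_one LM by blast
    \<comment> \<open>Write \<one> = m + ra with m in \<open>K\<close>. As \<open>K\<close> is
      proper, ra is not in \<open>K\<close>, hence not in the radical, so \<open>PJ\<close> leaves
      only ra = a and 1 - a = m.\<close>
    have compl: "\<one> \<ominus> a \<in> K" if K: "K \<in> Max_left R" for K
    proof -
      have LK: "left_ideal K R" "K \<noteq> carrier R" using K unfolding Max_left_def by auto
      have "a \<notin> K" using none K by blast
      then obtain m r where mr: "m \<in> K" "r \<in> carrier R" "\<one> = m \<oplus> r \<otimes> a"
        using Max_left_comaximal[OF K a(1)] by (metis one_closed)
      have "r \<otimes> a \<notin> K"
        using mr left_idealD(3)[OF LK(1)] left_ideal_one[OF LK(1)] LK(2) by metis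
      then have "r \<otimes> a = a" using PJ JM[OF K] mr(2) by blast
      then have "\<one> \<ominus> a = m"
        using mr a left_idealD(1)[OF LK(1)] by (auto simp: minus_eq a_assoc r_neg)
      then show ?thesis using mr by simp
    qed
    have xR: "x \<in> carrier R" using x MD(1) by blast
    have f: "\<one> \<ominus> a \<in> ?J" using compl a unfolding Jacobson_radical_def by auto
    \<comment> \<open>Since x and 1 - a lie in \<open>M\<close>, so does xa, whereas
      \<open>a\<close> does not. By \<open>PJ\<close> xa is then in the radical, and so is x = xa +
      x(1 - a).\<close>
    have "x \<otimes> a = x \<ominus> x \<otimes> (\<one> \<ominus> a)"
      using xR a by (simp add: minus_eq r_distr r_minus minus_add a_assoc[symmetric] r_neg)
    moreover have "x \<ominus> x \<otimes> (\<one> \<ominus> a) \<in> M" using MD x xR compl[OF M] by simp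
    ultimately have "x \<otimes> a \<noteq> a" using aM by auto
    then have xa: "x \<otimes> a \<in> ?J" using PJ xR by blast
    have "x = x \<otimes> a \<oplus> x \<otimes> (\<one> \<ominus> a)"
      using xR a by (simp add: minus_eq r_distr r_minus a_lcomm r_neg)
    moreover have "x \<otimes> a \<oplus> x \<otimes> (\<one> \<ominus> a) \<in> K" if "K \<in> Max_left R" for K
    proof -
      have "left_ideal K R" using that unfolding Max_left_def by auto
      then show ?thesis using left_idealD xa f JM[OF that] xR by (meson subsetD)
    qed
    ultimately show "x \<in> ?J" using xR unfolding Jacobson_radical_def by auto
  qed
  have "L = N" using M_J[OF two(1)] M_J[OF two(2)] JM[OF two(1)] JM[OF two(2)] by blast
  then show False using two(3) by blast
qed

section \<open>From the graph condition to a central idempotent\<close>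

theorem theorem5:
  fixes R :: "('a, 'm) ring_scheme"
  assumes "ring R"
    and "\<exists>M\<in>Max_left R. \<exists>N\<in>Max_left R. M \<noteq> N"
    and "\<exists>a\<in>vertices (comaximal_graph2_minus_J R).
           \<forall>b\<in>vertices (comaximal_graph2_minus_J R).
             b \<noteq> a \<longrightarrow> adjacent (comaximal_graph2_minus_J R) a b"
  shows "\<exists>D :: 'a ring. division_ring D \<and> R \<simeq> RDirProd (residue_ring 2) D"
proof -
  interpret ring R by fact
  let ?J = "Jacobson_radical R"
  obtain a where a: "a \<in> carrier R" "a \<notin> left_units R" "a \<notin> ?J"
    and adj: "\<And>b. b \<in> carrier R \<Longrightarrow> b \<notin> left_units R \<Longrightarrow> b \<notin> ?J \<Longrightarrow> b \<noteq> a
      \<Longrightarrow> (carrier R #>\<^bsub>R\<^esub> a) <+>\<^bsub>R\<^esub> (carrier R #>\<^bsub>R\<^esub> b) = carrier R"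
    using assms(3) unfolding comaximal_graph2_minus_J_def comaximal_graph2_def
      comaximal_graph_def induced_subgraph_def by auto
  have dom: "\<exists>r\<in>carrier R. \<exists>s\<in>carrier R. \<one>\<^bsub>R\<^esub> = r \<otimes>\<^bsub>R\<^esub> a \<oplus>\<^bsub>R\<^esub> s \<otimes>\<^bsub>R\<^esub> b"
    if "b \<in> carrier R" "b \<notin> left_units R" "b \<notin> ?J" "b \<noteq> a" for b
  proof -
    have "\<one>\<^bsub>R\<^esub> \<in> (carrier R #>\<^bsub>R\<^esub> a) <+>\<^bsub>R\<^esub> (carrier R #>\<^bsub>R\<^esub> b)"
      using adj[OF that] by simp
    then show ?thesis unfolding set_add_def' r_coset_def by auto
  qed
  obtain M where M: "M \<in> Max_left R" "a \<in> M"
    using dominating_in_Max_left[OF a(1,2) dom] assms(2) by blast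
  have LM: "left_ideal M R" "M \<noteq> carrier R" using M unfolding Max_left_def by auto
  note MD = left_idealD[OF LM(1)]
  have MJ: "M \<subseteq> insert a ?J" using dominating_left_ideal[OF a(1) dom LM M(2)] .
  have M_eq: "M = {\<zero>\<^bsub>R\<^esub>, a}"
  proof
    show "{\<zero>\<^bsub>R\<^esub>, a} \<subseteq> M" using MD M by simp
    show "M \<subseteq> {\<zero>\<^bsub>R\<^esub>, a}"
    proof (rule subsetI, rule ccontr)
      \<comment> \<open>Such a j lies in the radical, and so does a + j, an element of
        \<open>M\<close> different from \<open>a\<close>. Their difference \<open>a\<close> would
        then be in every maximal left ideal.\<close>
      fix j assume j: "j \<in> M" "j \<notin> {\<zero>\<^bsub>R\<^esub>, a}"
      have jR: "j \<in> carrier R" and jJ: "j \<in> ?J" using j MJ MD(1) by auto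
      have "a \<oplus>\<^bsub>R\<^esub> j \<noteq> a" using j jR a by (simp add: add.r_cancel_one)
      moreover have "a \<oplus>\<^bsub>R\<^esub> j \<in> M" using j M MD(3) by simp
      ultimately have ajJ: "a \<oplus>\<^bsub>R\<^esub> j \<in> ?J" using MJ by blast
      have "a \<in> K" if K: "K \<in> Max_left R" for K
      proof -
        have "left_ideal K R" using K unfolding Max_left_def by auto
        moreover have "a \<oplus>\<^bsub>R\<^esub> j \<in> K" "j \<in> K"
          using ajJ jJ K unfolding Jacobson_radical_def by auto
        ultimately have "(a \<oplus>\<^bsub>R\<^esub> j) \<ominus>\<^bsub>R\<^esub> j \<in> K" by (rule left_idealD(4))
        then show ?thesis using a jR by (simp add: minus_eq a_assoc r_neg)
      qed
      then show False using a unfolding Jacobson_radical_def by blast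
    qed
  qed
  have two: "r \<otimes>\<^bsub>R\<^esub> a = \<zero>\<^bsub>R\<^esub> \<or> r \<otimes>\<^bsub>R\<^esub> a = a" if "r \<in> carrier R" for r
    using MD(5)[OF that M(2)] unfolding M_eq by simp
  obtain N where N: "N \<in> Max_left R" "a \<notin> N"
    using a(1,3) unfolding Jacobson_radical_def by blast
  have LN: "left_ideal N R" "N \<noteq> carrier R" using N unfolding Max_left_def by auto
  note ND = left_idealD[OF LN(1)]
  have a0: "a \<noteq> \<zero>\<^bsub>R\<^esub>" using ND(2) N(2) by auto
  have a1: "a \<noteq> \<one>\<^bsub>R\<^esub>" using a unfolding left_units_def by auto
  define f where "f = \<one>\<^bsub>R\<^esub> \<ominus>\<^bsub>R\<^esub> a"
  have fR: "f \<in> carrier R" and f0: "f \<noteq> \<zero>\<^bsub>R\<^esub>" using a a1 by (auto simp: f_def)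
  \<comment> \<open>In \<one> = m + ra with m in \<open>N\<close>, the case ra = 0 would put \<one>
    into \<open>N\<close>; so ra = a and m = f.\<close>
  have fN: "f \<in> N"
  proof -
    obtain m r where mr: "m \<in> N" "r \<in> carrier R" "\<one>\<^bsub>R\<^esub> = m \<oplus>\<^bsub>R\<^esub> r \<otimes>\<^bsub>R\<^esub> a"
      using Max_left_comaximal[OF N(1) a(1) N(2) one_closed] by blast
    have mR: "m \<in> carrier R" using mr ND(1) by blast
    have "r \<otimes>\<^bsub>R\<^esub> a \<noteq> \<zero>\<^bsub>R\<^esub>" using mr mR left_ideal_one[OF LN(1)] LN(2) by auto
    then have "f = m"
      using two[OF mr(2)] mr mR a by (auto simp: f_def minus_eq a_assoc r_neg)
    then show ?thesis using mr by simp
  qed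
  \<comment> \<open>af = a - aa is in \<open>M\<close> as a difference and in \<open>N\<close> as a
    left multiple of \<open>f\<close>. These ideals meet only in 0, because \<open>a\<close> is not
    in \<open>N\<close>; so aa = a.\<close>
  have af: "a \<otimes>\<^bsub>R\<^esub> f = a \<ominus>\<^bsub>R\<^esub> a \<otimes>\<^bsub>R\<^esub> a"
    using a by (simp add: f_def minus_eq r_distr r_minus)
  have "a \<otimes>\<^bsub>R\<^esub> f \<in> M" unfolding af using MD M a by simp
  moreover have "a \<otimes>\<^bsub>R\<^esub> f \<in> N" using ND(5)[OF a(1) fN] .
  ultimately have af0: "a \<otimes>\<^bsub>R\<^esub> f = \<zero>\<^bsub>R\<^esub>" using M_eq N by auto
  then have idem: "a \<otimes>\<^bsub>R\<^esub> a = a" using af a by simp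
  have fa0: "f \<otimes>\<^bsub>R\<^esub> a = \<zero>\<^bsub>R\<^esub>"
    using a idem by (simp add: f_def minus_eq l_distr l_minus r_neg)
  have simple: "\<exists>s\<in>carrier R. s \<otimes>\<^bsub>R\<^esub> x = f"
    if x: "x \<in> carrier R" "x \<otimes>\<^bsub>R\<^esub> a = \<zero>\<^bsub>R\<^esub>" "x \<noteq> \<zero>\<^bsub>R\<^esub>" for x
  proof -
    \<comment> \<open>\<open>M\<close> meets the annihilator of \<open>a\<close> only in 0, because
      aa = a is nonzero. So f = m + sx, and right multiplication by \<open>a\<close> gives ma = 0,
      hence m = 0.\<close>
    have "x \<notin> M" using x idem a0 M_eq by auto
    then obtain m s where ms: "m \<in> M" "s \<in> carrier R" "f = m \<oplus>\<^bsub>R\<^esub> s \<otimes>\<^bsub>R\<^esub> x"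
      using Max_left_comaximal[OF M(1) x(1) _ fR] by blast
    have mR: "m \<in> carrier R" using ms MD(1) by blast
    have "f \<otimes>\<^bsub>R\<^esub> a = m \<otimes>\<^bsub>R\<^esub> a"
      using ms mR x a by (simp add: l_distr m_assoc)
    then have "m = \<zero>\<^bsub>R\<^esub>" using fa0 ms(1) idem a0 M_eq by auto
    then show ?thesis using ms x by auto
  qed
  have arf: "a \<otimes>\<^bsub>R\<^esub> r \<otimes>\<^bsub>R\<^esub> f = \<zero>\<^bsub>R\<^esub>" if r: "r \<in> carrier R" for r
  proof (rule ccontr)
    let ?x = "a \<otimes>\<^bsub>R\<^esub> r \<otimes>\<^bsub>R\<^esub> f"
    assume "?x \<noteq> \<zero>\<^bsub>R\<^esub>"
    moreover have "?x \<otimes>\<^bsub>R\<^esub> a = \<zero>\<^bsub>R\<^esub>" using a r fR fa0 by (simp add: m_assoc)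
    ultimately obtain s where s: "s \<in> carrier R" "s \<otimes>\<^bsub>R\<^esub> ?x = f"
      using simple[of ?x] a r fR by auto
    \<comment> \<open>Here sa is 0 or a, and f \<noteq> 0 excludes 0. So f = arf, and left
      multiplication by \<open>a\<close> gives af = f, contradicting af = 0.\<close>
    then have "f = (s \<otimes>\<^bsub>R\<^esub> a) \<otimes>\<^bsub>R\<^esub> (r \<otimes>\<^bsub>R\<^esub> f)" using a r fR by (simp add: m_assoc)
    then have f_eq: "f = a \<otimes>\<^bsub>R\<^esub> (r \<otimes>\<^bsub>R\<^esub> f)" using two[OF s(1)] f0 r fR by auto
    then have "a \<otimes>\<^bsub>R\<^esub> f = (a \<otimes>\<^bsub>R\<^esub> a) \<otimes>\<^bsub>R\<^esub> (r \<otimes>\<^bsub>R\<^esub> f)"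
      using a r fR by (metis m_assoc m_closed)
    then show False using f_eq idem af0 f0 by simp
  qed
  \<comment> \<open>\<open>arf\<close> gives ar = ara, and since ra is 0 or a, idempotence gives
    a(ra) = ra.\<close>
  have central: "a \<otimes>\<^bsub>R\<^esub> r = r \<otimes>\<^bsub>R\<^esub> a" if r: "r \<in> carrier R" for r
  proof -
    have "a \<otimes>\<^bsub>R\<^esub> r \<ominus>\<^bsub>R\<^esub> a \<otimes>\<^bsub>R\<^esub> r \<otimes>\<^bsub>R\<^esub> a = \<zero>\<^bsub>R\<^esub>"
      using arf[OF r] a r by (simp add: f_def minus_eq r_distr r_minus)
    then have "a \<otimes>\<^bsub>R\<^esub> r = a \<otimes>\<^bsub>R\<^esub> (r \<otimes>\<^bsub>R\<^esub> a)" using a r by (simp add: m_assoc)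
    also have "\<dots> = r \<otimes>\<^bsub>R\<^esub> a" using two[OF r] a idem by auto
    finally show ?thesis .
  qed
  \<comment> \<open>The division ring is the annihilator of \<open>a\<close> with identity
    \<open>f\<close>; being a subset of \<open>R\<close>, it lives on the same type.\<close>
  show ?thesis
    using division_ring_annihilator[OF a(1) idem a1 central]
      iso_RDirProd_annihilator[OF a(1) idem a0 central two] simple
    unfolding f_def by blast
qed

end
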